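(* Let $\omega\notin2\pi\mathbb Q$, $b\in\mathbb R$, let $g:\mathbb T\to\mathbb R$ be continuous and $h:\mathbb R\to\mathbb R$ be continuous and monotone increasing, and consider the quasiperiodically forced map $(x,\theta)\mapsto(h(x)-b\,g(\theta),\ \theta+\omega \bmod 2\pi)$. Assume that there exists a continuous curve $f_0:\mathbb T\to\mathbb R$ such that: - the sequence defined by $$f_n(\theta):=h(f_{n-1}(\theta-\omega))-b\,g(\theta-\omega)\qquad(n\ge1)$$ has a pointwise limit $f_\infty$; - either $f_\infty(\theta)\le f_0(\theta)$ for all $\theta\in\mathbb T$, or $f_\infty(\theta)\ge f_0(\theta)$ for all $\theta\in\mathbb T$. Define the sequences of curves $$f_m^{\downarrow}(\theta):=\inf_{k\le m}f_k(\theta),\qquad f_m^{\uparrow}(\theta):=\sup_{k\le m}f_k(\theta).$$ Then $f_\infty$ is invariant, and $f_\infty$ is continuous if and only if either $\{f_m^{\downarrow}\}_m$ or $\{f_m^{\uparrow}\}_m$ is uniformly convergent. In particular: - if $f_\infty\le f_0$, then $f_\infty$ is continuous if and only if $\{f_m^{\downarrow}\}_m$ is uniformly convergent; - if $f_\infty\ge f_0$, then $f_\infty$ is continuous if and only if $\{f_m^{\uparrow}\}_m$ is uniformly convergent.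
   Context: $\mathbb T=\mathbb R/2\pi\mathbb Z$. A curve $\varphi:\mathbb T\to\mathbb R$ (not necessarily continuous) is invariant for the map if $\varphi(\theta)=h(\varphi(\theta-\omega))-b\,g(\theta-\omega)$ for all $\theta\in\mathbb T$. The infimum and supremum defining $f_m^{\downarrow}$ and $f_m^{\uparrow}$ are over the indices $0\le k\le m$.
   Formalization: In the first equivalence, "uniformly convergent" is read as uniformly convergent to f_∞: as written it fails, since if all f_n ≤ f_0 then f_m^↑ = f_0 converges uniformly even when f_∞ is discontinuous. The two "in particular" items are unchanged. *)

theory Defs
  imports "HOL-Analysis.Analysis"
begin

definition cong_2pi :: "real \<Rightarrow> real \<Rightarrow> bool" where
  "cong_2pi x y \<longleftrightarrow> (\<exists>k::int. x - y = 2 * pi * of_int k)"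

lemma equivp_cong_2pi: "equivp cong_2pi"
proof (rule equivpI)
  show "reflp cong_2pi"
    by (auto simp: reflp_def cong_2pi_def intro: exI[of _ 0])
  show "symp cong_2pi"
  proof (rule sympI)
    fix x y assume "cong_2pi x y"
    then obtain k :: int where "x - y = 2 * pi * of_int k"
      by (auto simp: cong_2pi_def)
    then have "y - x = 2 * pi * of_int (- k)"
      by simp
    then show "cong_2pi y x"
      unfolding cong_2pi_def by blast
  qed
  show "transp cong_2pi"
  proof (rule transpI)
    fix x y z assume "cong_2pi x y" "cong_2pi y z"
    then obtain k l :: int where "x - y = 2 * pi * of_int k" "y - z = 2 * pi * of_int l"
      by (auto simp: cong_2pi_def)
    then have "x - z = 2 * pi * of_int (k + l)"
      by (simp add: algebra_simps)
    then show "cong_2pi x z"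
      unfolding cong_2pi_def by blast
  qed
qed

text \<open>The circle \<open>\<real> / 2\<pi>\<int>\<close>; \<open>circ x\<close> is the class of the real number \<open>x\<close>.\<close>

quotient_type circle = real / cong_2pi
  by (rule equivp_cong_2pi)

lift_definition circ :: "real \<Rightarrow> circle" is "\<lambda>x. x" .

instantiation circle :: ab_group_add
begin

lift_definition zero_circle :: circle is 0 .

lift_definition plus_circle :: "circle \<Rightarrow> circle \<Rightarrow> circle" is "(+)"
proof -
  fix x x' y y' assume "cong_2pi x x'" "cong_2pi y y'"
  then obtain k l :: int where "x - x' = 2 * pi * of_int k" "y - y' = 2 * pi * of_int l"
    by (auto simp: cong_2pi_def)
  then have "x + y - (x' + y') = 2 * pi * of_int (k + l)"
    by (simp add: algebra_simps)
  then show "cong_2pi (x + y) (x' + y')"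
    unfolding cong_2pi_def by blast
qed

lift_definition uminus_circle :: "circle \<Rightarrow> circle" is uminus
proof -
  fix x x' assume "cong_2pi x x'"
  then obtain k :: int where "x - x' = 2 * pi * of_int k"
    by (auto simp: cong_2pi_def)
  then have "- x - (- x') = 2 * pi * of_int (- k)"
    by simp
  then show "cong_2pi (- x) (- x')"
    unfolding cong_2pi_def by blast
qed

definition minus_circle :: "circle \<Rightarrow> circle \<Rightarrow> circle" where
  "minus_circle a b = a + (- b)"

instance
proof
  fix a b c :: circle
  have refl: "cong_2pi x x" for x
    using equivp_cong_2pi by (rule equivp_reflp)
  show "a + b + c = a + (b + c)"
    by transfer (simp add: add.assoc refl)
  show "a + b = b + a"
    by transfer (simp add: add.commute refl)
  show "0 + a = a"
    by transfer (simp add: refl)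
  show "- a + a = 0"
    by transfer (simp add: refl)
  show "a - b = a + - b"
    by (rule minus_circle_def)
qed

end

text \<open>The circle carries the quotient topology.\<close>

instantiation circle :: topological_space
begin

definition open_circle :: "circle set \<Rightarrow> bool" where
  "open_circle U \<longleftrightarrow> open (circ -` U)"

instance
  by standard (auto simp: open_circle_def vimage_Union)

end

definition forced_map ::
    "(real \<Rightarrow> real) \<Rightarrow> real \<Rightarrow> (circle \<Rightarrow> real) \<Rightarrow> real \<Rightarrow> real \<times> circle \<Rightarrow> real \<times> circle" where
  "forced_map h b g \<omega> = (\<lambda>(x, \<theta>). (h x - b * g \<theta>, \<theta> + circ \<omega>))"

text \<open>Invariant curves are not required to be continuous.\<close>

definition invariant_curve ::
    "(real \<Rightarrow> real) \<Rightarrow> real \<Rightarrow> (circle \<Rightarrow> real) \<Rightarrow> real \<Rightarrow> (circle \<Rightarrow> real) \<Rightarrow> bool" where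
  "invariant_curve h b g \<omega> \<phi> \<longleftrightarrow>
     (\<forall>\<theta>. \<phi> \<theta> = h (\<phi> (\<theta> - circ \<omega>)) - b * g (\<theta> - circ \<omega>))"

lemma invariant_curve_iff_forced_map:
  "invariant_curve h b g \<omega> \<phi> \<longleftrightarrow>
     (\<forall>\<theta>. forced_map h b g \<omega> (\<phi> \<theta>, \<theta>) = (\<phi> (\<theta> + circ \<omega>), \<theta> + circ \<omega>))"
  unfolding invariant_curve_def forced_map_def
  by (simp, metis add_diff_cancel diff_add_cancel)

text \<open>Pitfall: the envelope on the wrong side of the limit curve may converge uniformly to
  another function. If \<open>f n \<le> f 0\<close> for all \<open>n\<close>, then \<open>upper_envelope f m = f 0\<close> for all \<open>m\<close>,
  whether or not the limit of \<open>f\<close> is continuous. When the side is not fixed, uniform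
  convergence of an envelope therefore has to name its limit.\<close>

definition lower_envelope :: "(nat \<Rightarrow> circle \<Rightarrow> real) \<Rightarrow> nat \<Rightarrow> circle \<Rightarrow> real" where
  "lower_envelope f m \<theta> = (INF k\<in>{..m}. f k \<theta>)"

definition upper_envelope :: "(nat \<Rightarrow> circle \<Rightarrow> real) \<Rightarrow> nat \<Rightarrow> circle \<Rightarrow> real" where
  "upper_envelope f m \<theta> = (SUP k\<in>{..m}. f k \<theta>)"

end

theory Submission
  imports Defs
begin

text \<open>The fibre maps are monotone, so a limit curve lying on one side of \<open>f 0\<close> lies on the same
  side of every iterate. The envelope on that side is then squeezed between the iterates and their
  limit, and Dini's theorem on the compact circle gives uniform convergence when the limit is
  continuous.\<close>

section \<open>The circle: compactness and continuity of rotations\<close>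

lemma continuous_on_circ: "continuous_on A circ"
proof (rule continuous_on_subset)
  show "continuous_on UNIV circ"
    by (auto simp: continuous_on_open_vimage open_circle_def)
qed simp

lemma circ_add: "circ (x + y) = circ x + circ y"
  by transfer (rule equivp_reflp[OF equivp_cong_2pi])

lemma circ_diff: "circ (x - y) = circ x - circ y"
  using circ_add[of "x - y" y] by (simp add: algebra_simps)

lemma circ_eq_iff: "circ x = circ y \<longleftrightarrow> cong_2pi x y"
  by transfer (rule refl)

text \<open>A closed fundamental interval is taken, endpoints identified, so that the circle becomes
  a continuous image of a compact set.\<close>

lemma circ_surj_on: "circ ` {0..2 * pi} = UNIV"
proof -
  have "t \<in> circ ` {0..2 * pi}" for t
  proof -
    obtain x where x: "t = circ x"
      unfolding circ.abs_eq by (induct t rule: circle.abs_induct) blast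
    \<comment> \<open>\<open>k\<close> counts the full turns to remove from the representative
      \<open>x\<close>.\<close>
    define k where "k = \<lfloor>x / (2 * pi)\<rfloor>"
    have "of_int k \<le> x / (2 * pi)" "x / (2 * pi) < of_int k + 1"
      unfolding k_def by linarith+
    then have "x - 2 * pi * of_int k \<in> {0..2 * pi}"
      by (simp add: field_simps)
    moreover have "t = circ (x - 2 * pi * of_int k)"
      unfolding x circ_eq_iff by (auto simp: cong_2pi_def)
    ultimately show ?thesis by blast
  qed
  then show ?thesis by blast
qed

lemma compact_circle: "compact (UNIV :: circle set)"
  using compact_continuous_image[OF continuous_on_circ compact_Icc, of 0 "2 * pi"]
  by (simp add: circ_surj_on)

text \<open>In the quotient topology openness is tested on preimages under \<open>circ\<close>, and
  there the rotation lifts to a translation of the real line.\<close>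

lemma continuous_on_circle_diff: "continuous_on UNIV (\<lambda>t :: circle. t - circ c)"
proof -
  have "open ((\<lambda>t. t - circ c) -` U)" if "open U" for U
  proof -
    have "circ -` (\<lambda>t. t - circ c) -` U = (\<lambda>x. x - c) -` circ -` U"
      by (auto simp: circ_diff)
    moreover have "open ((\<lambda>x. x - c) -` circ -` U)"
      using that unfolding open_circle_def by (rule open_vimage) (intro continuous_intros)
    ultimately show ?thesis
      unfolding open_circle_def by simp
  qed
  then show ?thesis
    by (auto simp: continuous_on_open_vimage)
qed

section \<open>Envelopes as finite minima and maxima\<close>

lemma lower_envelope_le: "k \<le> m \<Longrightarrow> lower_envelope f m t \<le> f k t"
  unfolding lower_envelope_def by (rule cINF_lower) auto

lemma lower_envelope_greatest: "(\<And>k. k \<le> m \<Longrightarrow> c \<le> f k t) \<Longrightarrow> c \<le> lower_envelope f m t"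
  unfolding lower_envelope_def by (rule cINF_greatest) auto

lemma lower_envelope_Suc: "lower_envelope f (Suc m) t = min (f (Suc m) t) (lower_envelope f m t)"
  unfolding lower_envelope_def atMost_Suc
  by (subst cINF_insert) (auto simp: inf_min)

text \<open>The reflection of the fibre swaps the two envelopes, so results on suprema follow from
  those on infima.\<close>

lemma upper_envelope_eq_uminus_lower:
  "upper_envelope f = (\<lambda>m t. - lower_envelope (\<lambda>k t. - f k t) m t)"
  unfolding upper_envelope_def lower_envelope_def
  by (intro ext, subst uminus_cINF) auto

lemma continuous_on_lower_envelope:
  assumes "\<And>n. continuous_on UNIV (f n)"
  shows "continuous_on UNIV (lower_envelope f m)"
proof (induction m)
  case 0
  have "lower_envelope f 0 = f 0"
    by (simp add: lower_envelope_def fun_eq_iff)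
  then show ?case
    using assms by simp
next
  case (Suc m)
  have "lower_envelope f (Suc m) = (\<lambda>t. min (f (Suc m) t) (lower_envelope f m t))"
    by (simp add: lower_envelope_Suc fun_eq_iff)
  then show ?case
    using assms Suc by (simp add: continuous_on_min)
qed

lemma continuous_on_upper_envelope:
  assumes "\<And>n. continuous_on UNIV (f n)"
  shows "continuous_on UNIV (upper_envelope f m)"
  unfolding upper_envelope_eq_uminus_lower
  by (intro continuous_on_minus continuous_on_lower_envelope assms)

lemma lower_envelope_tendsto:
  assumes "(\<lambda>n. f n t) \<longlonglongrightarrow> l t" and "\<And>n. l t \<le> f n t"
  shows "(\<lambda>m. lower_envelope f m t) \<longlonglongrightarrow> l t"
\<comment> \<open>The index \<open>k = m\<close> belongs to the infimum, so the envelope lies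
  between \<open>l t\<close> and \<open>f m t\<close>.\<close>
proof (rule tendsto_sandwich[OF _ _ tendsto_const assms(1)])
  show "\<forall>\<^sub>F m in sequentially. l t \<le> lower_envelope f m t"
    by (intro always_eventually allI lower_envelope_greatest assms(2))
  show "\<forall>\<^sub>F m in sequentially. lower_envelope f m t \<le> f m t"
    by (simp add: lower_envelope_le)
qed

text \<open>This is Dini's argument. The iterates need not be monotone in \<open>n\<close>; once
  some \<open>f n\<close> is close to \<open>l\<close> at a point, every later envelope is at least
  as close there.\<close>

lemma uniform_limit_lower_envelope:
  assumes cont: "\<And>n. continuous_on UNIV (f n)" "continuous_on UNIV l"
    and lim: "\<And>t. (\<lambda>n. f n t) \<longlonglongrightarrow> l t" and le: "\<And>n t. l t \<le> f n t"
  shows "uniform_limit UNIV (lower_envelope f) l sequentially"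
  unfolding uniform_limit_sequentially_iff
proof (intro allI impI)
  fix e :: real assume "e > 0"
  \<comment> \<open>The set where the \<open>n\<close>-th iterate is within \<open>e\<close> of the
    limit: open because both curves are continuous, and by pointwise convergence these sets cover
    the circle.\<close>
  define U where "U n = {t. f n t < l t + e}" for n
  have U_open: "open (U n)" for n
    unfolding U_def by (intro open_Collect_less continuous_intros cont)
  have U_cover: "t \<in> (\<Union>n\<in>UNIV. U n)" for t
  proof -
    have "\<forall>\<^sub>F n in sequentially. f n t < l t + e"
      using \<open>e > 0\<close> by (intro order_tendstoD(2)[OF lim]) simp
    then show ?thesis
      unfolding U_def eventually_sequentially by auto
  qed
  obtain C where C: "finite C" "UNIV \<subseteq> (\<Union>n\<in>C. U n)"
    by (rule compactE_image[OF compact_circle, of UNIV U, OF U_open subsetI]) (rule U_cover)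
  \<comment> \<open>From \<open>Max C\<close> on, the envelope takes in every index of the finite
    subcover, whichever of its sets contains \<open>t\<close>.\<close>
  have "dist (lower_envelope f m t) (l t) < e" if m: "m \<ge> Max C" for m t
  proof -
    obtain n where n: "n \<in> C" "t \<in> U n"
      using C(2) by blast
    have "n \<le> m"
      using Max_ge[OF C(1) n(1)] m by simp
    then have "lower_envelope f m t < l t + e"
      using lower_envelope_le[of n m f t] n(2) by (simp add: U_def)
    moreover have "l t \<le> lower_envelope f m t"
      by (rule lower_envelope_greatest) (rule le)
    ultimately show ?thesis
      by (simp add: dist_real_def)
  qed
  then show "\<exists>N. \<forall>m\<ge>N. \<forall>t\<in>UNIV. dist (lower_envelope f m t) (l t) < e"
    by blast
qed

text \<open>One direction is Dini, the other the continuity of a uniform limit of continuous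
  envelopes. The second form leaves the limit unnamed, which is possible on this side because the
  envelopes already converge pointwise to \<open>l\<close>.\<close>

lemma lower_envelope_uniform_iff:
  assumes cont: "\<And>n. continuous_on UNIV (f n)"
    and lim: "\<And>t. (\<lambda>n. f n t) \<longlonglongrightarrow> l t" and le: "\<And>n t. l t \<le> f n t"
  shows "continuous_on UNIV l \<longleftrightarrow> uniform_limit UNIV (lower_envelope f) l sequentially"
    and "continuous_on UNIV l \<longleftrightarrow> uniformly_convergent_on UNIV (lower_envelope f)"
proof -
  show 1: "continuous_on UNIV l \<longleftrightarrow> uniform_limit UNIV (lower_envelope f) l sequentially"
    using uniform_limit_lower_envelope[OF cont _ lim le]
      uniform_limit_theorem[OF always_eventually, of UNIV "lower_envelope f" l sequentially]
      continuous_on_lower_envelope[OF cont]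
    by auto
  have "l' = l" if "uniform_limit UNIV (lower_envelope f) l' sequentially" for l'
  proof
    fix t
    show "l' t = l t"
      using tendsto_uniform_limitI[OF that UNIV_I] lower_envelope_tendsto[of f t l, OF lim le]
      by (rule LIMSEQ_unique)
  qed
  then show "continuous_on UNIV l \<longleftrightarrow> uniformly_convergent_on UNIV (lower_envelope f)"
    unfolding 1 uniformly_convergent_on_def by blast
qed

text \<open>Serves to carry uniform limits through the reflection that exchanges the
  envelopes.\<close>

lemma uniform_limit_uminus_iff:
  fixes F :: "'a \<Rightarrow> 'b \<Rightarrow> real"
  shows "uniform_limit S (\<lambda>n x. - F n x) l G \<longleftrightarrow> uniform_limit S F (\<lambda>x. - l x) G"
  unfolding uniform_limit_iff by (simp add: dist_real_def abs_minus_commute add.commute)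

text \<open>Follows from the lower case applied to the negated iterates and the negated
  limit.\<close>

lemma upper_envelope_uniform_iff:
  assumes cont: "\<And>n. continuous_on UNIV (f n)"
    and lim: "\<And>t. (\<lambda>n. f n t) \<longlonglongrightarrow> l t" and ge: "\<And>n t. f n t \<le> l t"
  shows "continuous_on UNIV l \<longleftrightarrow> uniform_limit UNIV (upper_envelope f) l sequentially"
    and "continuous_on UNIV l \<longleftrightarrow> uniformly_convergent_on UNIV (upper_envelope f)"
proof -
  let ?f = "\<lambda>k t. - f k t" and ?l = "\<lambda>t. - l t"
  have cont_iff: "continuous_on UNIV ?l \<longleftrightarrow> continuous_on UNIV l"
    using continuous_on_minus[of UNIV l] continuous_on_minus[of UNIV ?l] by auto
  have conv_iff: "uniformly_convergent_on UNIV (upper_envelope f)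
      \<longleftrightarrow> uniformly_convergent_on UNIV (lower_envelope ?f)"
  proof
    assume "uniformly_convergent_on UNIV (lower_envelope ?f)"
    then obtain l' where "uniform_limit UNIV (lower_envelope ?f) l' sequentially"
      by (auto simp: uniformly_convergent_on_def)
    then show "uniformly_convergent_on UNIV (upper_envelope f)"
      unfolding upper_envelope_eq_uminus_lower
      by (intro uniformly_convergentI[of _ _ "\<lambda>t. - l' t"]) (rule uniform_limit_uminus)
  next
    assume "uniformly_convergent_on UNIV (upper_envelope f)"
    then show "uniformly_convergent_on UNIV (lower_envelope ?f)"
      unfolding upper_envelope_eq_uminus_lower
      by (auto simp: uniformly_convergent_on_def uniform_limit_uminus_iff)
  qed
  have neg: "continuous_on UNIV (?f n)" "(\<lambda>n. ?f n t) \<longlonglongrightarrow> ?l t" "?l t \<le> ?f n t" for n t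
    using cont lim ge by (auto intro: continuous_on_minus tendsto_minus)
  note iff = lower_envelope_uniform_iff[of ?f ?l, OF neg]
  show "continuous_on UNIV l \<longleftrightarrow> uniform_limit UNIV (upper_envelope f) l sequentially"
    using iff(1) unfolding cont_iff upper_envelope_eq_uminus_lower uniform_limit_uminus_iff .
  show "continuous_on UNIV l \<longleftrightarrow> uniformly_convergent_on UNIV (upper_envelope f)"
    using iff(2) unfolding cont_iff conv_iff .
qed

theorem theorem3p11:
  fixes \<omega> b :: real
    and g :: "circle \<Rightarrow> real"
    and h :: "real \<Rightarrow> real"
    and f :: "nat \<Rightarrow> circle \<Rightarrow> real"
    and f_inf :: "circle \<Rightarrow> real"
  assumes "\<omega> \<notin> (\<lambda>q. 2 * pi * q) ` \<rat>"
    and "continuous_on UNIV g"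
    and "continuous_on UNIV h" and "mono h"
    and "continuous_on UNIV (f 0)"
    and "\<And>n \<theta>. n \<ge> 1 \<Longrightarrow> f n \<theta> = h (f (n - 1) (\<theta> - circ \<omega>)) - b * g (\<theta> - circ \<omega>)"
    and "\<And>\<theta>. (\<lambda>n. f n \<theta>) \<longlonglongrightarrow> f_inf \<theta>"
    and "(\<forall>\<theta>. f_inf \<theta> \<le> f 0 \<theta>) \<or> (\<forall>\<theta>. f_inf \<theta> \<ge> f 0 \<theta>)"
  shows "invariant_curve h b g \<omega> f_inf
    \<and> (continuous_on UNIV f_inf \<longleftrightarrow>
         uniform_limit UNIV (lower_envelope f) f_inf sequentially
         \<or> uniform_limit UNIV (upper_envelope f) f_inf sequentially)
    \<and> ((\<forall>\<theta>. f_inf \<theta> \<le> f 0 \<theta>) \<longrightarrow>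
         (continuous_on UNIV f_inf \<longleftrightarrow> uniformly_convergent_on UNIV (lower_envelope f)))
    \<and> ((\<forall>\<theta>. f_inf \<theta> \<ge> f 0 \<theta>) \<longrightarrow>
         (continuous_on UNIV f_inf \<longleftrightarrow> uniformly_convergent_on UNIV (upper_envelope f)))"
proof -
  note g = assms(2) and h = assms(3) and mono = assms(4) and f0 = assms(5)
    and lim = assms(7) and side = assms(8)
  have rec: "f (Suc n) t = h (f n (t - circ \<omega>)) - b * g (t - circ \<omega>)" for n t
    using assms(6)[of "Suc n" t] by simp
  \<comment> \<open>Letting \<open>n\<close> tend to infinity in the recursion gives the invariance:
    the left side is a shifted copy of the sequence, and continuity of \<open>h\<close> handles the
    right side.\<close>
  have inv: "f_inf t = h (f_inf (t - circ \<omega>)) - b * g (t - circ \<omega>)" for t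
  proof (rule LIMSEQ_unique)
    show "(\<lambda>n. f (Suc n) t) \<longlonglongrightarrow> f_inf t"
      using lim by (rule LIMSEQ_Suc)
    have "isCont h x" for x
      using h by (simp add: continuous_on_eq_continuous_at)
    then show "(\<lambda>n. f (Suc n) t) \<longlonglongrightarrow> h (f_inf (t - circ \<omega>)) - b * g (t - circ \<omega>)"
      unfolding rec by (intro tendsto_intros isCont_tendsto_compose[of _ h] lim)
  qed
  have cont: "continuous_on UNIV (f n)" for n
  proof (induction n)
    case (Suc n)
    have "continuous_on UNIV (\<lambda>t. f n (t - circ \<omega>))" "continuous_on UNIV (\<lambda>t. g (t - circ \<omega>))"
      using continuous_on_compose2[OF _ continuous_on_circle_diff] Suc g by auto
    then have "continuous_on UNIV (\<lambda>t. h (f n (t - circ \<omega>)) - b * g (t - circ \<omega>))"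
      by (intro continuous_intros continuous_on_compose2[OF h]) auto
    then show ?case
      by (simp add: rec[abs_def])
  qed (rule f0)
  \<comment> \<open>Both \<open>f_inf\<close> and \<open>f (Suc n)\<close> are images under the same
    fibre map, of \<open>f_inf\<close> and \<open>f n\<close>. Monotone \<open>h\<close> followed by
    subtracting a common forcing term preserves their order.\<close>
  have below: "f_inf t \<le> f n t" if "\<forall>t. f_inf t \<le> f 0 t" for n t
  proof (induction n arbitrary: t)
    case (Suc n)
    then show ?case
      unfolding rec inv[of t] using monoD[OF mono] by simp
  qed (use that in simp)
  have above: "f n t \<le> f_inf t" if "\<forall>t. f_inf t \<ge> f 0 t" for n t
  proof (induction n arbitrary: t)
    case (Suc n)
    then show ?case
      unfolding rec inv[of t] using monoD[OF mono] by simp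
  qed (use that in simp)
  \<comment> \<open>These equivalences, and those for the upper envelope, remain conditional on the
    side of \<open>f 0\<close> on which \<open>f_inf\<close> lies.\<close>
  note lower = lower_envelope_uniform_iff[of f f_inf, OF cont lim below]
  note upper = upper_envelope_uniform_iff[of f f_inf, OF cont lim above]
  \<comment> \<open>This implication holds for either envelope regardless of the side, since the
    limit is named as \<open>f_inf\<close>. Only the converse has to choose the envelope according
    to \<open>side\<close>.\<close>
  have "continuous_on UNIV f_inf"
    if "uniform_limit UNIV (lower_envelope f) f_inf sequentially
      \<or> uniform_limit UNIV (upper_envelope f) f_inf sequentially"
    using that
      uniform_limit_theorem[OF always_eventually, of UNIV _ f_inf sequentially]
      continuous_on_lower_envelope[of f, OF cont] continuous_on_upper_envelope[of f, OF cont]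
    by auto
  then have "continuous_on UNIV f_inf \<longleftrightarrow>
         uniform_limit UNIV (lower_envelope f) f_inf sequentially
         \<or> uniform_limit UNIV (upper_envelope f) f_inf sequentially"
    using side lower(1) upper(1) by blast
  moreover have "invariant_curve h b g \<omega> f_inf"
    unfolding invariant_curve_def using inv by blast
  ultimately show ?thesis
    using lower(2) upper(2) by blast
qed

end
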